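(* Let $\mathcal{B}=(W,R)$ be a finite game board and let $M=(W,R,V)$ be a model extending $\mathcal{B}$ with an arbitrary valuation $V$. Then for every $k\in\mathbb{N}$, $$\{s\in W: M,s\vDash_{\mathsf{MISL}}\langle p:=\Box\bot;(p:=p\lor\Box\Diamond p)^k\rangle p\}=\mathsf{Win}_1^k .$$ More generally, $\{s\in W: M,s\vDash_{\mathsf{MISL}}\langle p:=\Box\bot;(p:=p\lor\Box\Diamond p)^*\rangle p\}=\mathsf{Win}_1$, the set of winning positions of player $1$.
   Context: Logic. $\mathcal{L}_{\mathsf{MISL}}$: $\varphi::=p\mid\neg\varphi\mid\varphi\land\varphi\mid\Diamond\varphi\mid\langle p:=\varphi\rangle\varphi\mid\langle(p:=\varphi)^*\rangle\varphi$, with $p$ from a countable set $\mathbf{P}$ of letters; $\top,\bot,\lor$ and $\Box=\neg\Diamond\neg$ are the usual abbreviations. A model is $M=(W,R,V)$ with $W\ne\emptyset$, $R\subseteq W\times W$, $V:\mathbf{P}\to2^W$. Truth: letters, Booleans and $\Diamond$ (along $R$) as usual; $M,w\vDash\langle p:=\psi\rangle\varphi$ iff $M|_{p:=\psi},w\vDash\varphi$, where $M|_{p:=\psi}$ is $M$ with the value of $p$ changed to $\{v\in W:M,v\vDash\psi\}$; $M,w\vDash\langle(p:=\psi)^*\rangle\varphi$ iff $M|_{(p:=\psi)^n},w\vDash\varphi$ for some $n\in\mathbb{N}$, where $M|_{(p:=\psi)^0}=M$ and $M|_{(p:=\psi)^{n+1}}=(M|_{(p:=\psi)^n})|_{p:=\psi}$.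 $\langle\alpha;\beta\rangle\varphi$ abbreviates $\langle\alpha\rangle\langle\beta\rangle\varphi$, and $(p:=\psi)^k$ denotes the $k$-fold composition of $p:=\psi$ (nothing for $k=0$). Game. A finite game board is $\mathcal{B}=(W,R)$ with $W$ a finite nonempty set of nodes and $R\subseteq W\times W$. For $s\in W$, the game $\mathcal{G}_s=(\mathcal{B},s)$ is played by players $0$ and $1$ with a token initially at $s$. In each round the players move the token alternately along $R$-arrows, with player $0$ moving first (a complete round consists of a move of player $0$ followed by a move of player $1$). A player wins whenever the opponent is to move but cannot; infinite plays are won by player $0$. For $i\in\{0,1\}$ and $k\in\mathbb{N}$, $\mathsf{Win}_i^k\subseteq W$ is the set of nodes $s$ such that player $i$ has a strategy to win $\mathcal{G}_s$ within $k$ rounds (so $\mathsf{Win}_1^0$ is the set of nodes with no $R$-successor), and $\mathsf{Win}_1=\bigcup_{k\in\mathbb{N}}\mathsf{Win}_1^k$. *)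

theory Defs
  imports Main "HOL-Library.Countable" "HOL-Library.Extended_Nat"
begin

section \<open>The logic MISL\<close>

datatype 'p fm =
    Atom 'p
  | Neg "'p fm"
  | Conj "'p fm" "'p fm"
  | Dia "'p fm"
  | Asg 'p "'p fm" "'p fm"      \<comment> \<open>\<open>Asg p \<psi> \<phi>\<close> is \<open>\<langle>p := \<psi>\<rangle>\<phi>\<close>\<close>
  | AsgStar 'p "'p fm" "'p fm"  \<comment> \<open>\<open>AsgStar p \<psi> \<phi>\<close> is \<open>\<langle>(p := \<psi>)*\<rangle>\<phi>\<close>\<close>

text \<open>
  The grammar has no constant for falsity; it is a contradiction over an arbitrary
  fixed letter.

  A program \<open>\<alpha>\<close> is represented by the formula operator mapping \<open>\<phi>\<close> to \<open>\<langle>\<alpha>\<rangle>\<phi>\<close>.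
  Since \<open>\<langle>\<alpha>;\<beta>\<rangle>\<phi>\<close> abbreviates \<open>\<langle>\<alpha>\<rangle>\<langle>\<beta>\<rangle>\<phi>\<close>, sequential composition of programs is function
  composition and \<open>(p := \<psi>)\<^sup>k\<close> is \<open>Asg p \<psi> ^^ k\<close>.
\<close>

abbreviation Bot :: "'p fm" where
  "Bot \<equiv> Conj (Atom undefined) (Neg (Atom undefined))"

abbreviation Disj :: "'p fm \<Rightarrow> 'p fm \<Rightarrow> 'p fm" where
  "Disj \<phi> \<psi> \<equiv> Neg (Conj (Neg \<phi>) (Neg \<psi>))"

abbreviation Box :: "'p fm \<Rightarrow> 'p fm" where
  "Box \<phi> \<equiv> Neg (Dia (Neg \<phi>))"

record ('w, 'p) model =
  worlds :: "'w set"
  acc :: "('w \<times> 'w) set"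
  val :: "'p \<Rightarrow> 'w set"

definition is_model :: "('w, 'p) model \<Rightarrow> bool" where
  "is_model M \<longleftrightarrow>
     worlds M \<noteq> {} \<and> acc M \<subseteq> worlds M \<times> worlds M \<and> (\<forall>q. val M q \<subseteq> worlds M)"

primrec sat :: "('w, 'p) model \<Rightarrow> 'w \<Rightarrow> 'p fm \<Rightarrow> bool" where
  "sat M w (Atom p) \<longleftrightarrow> w \<in> val M p"
| "sat M w (Neg \<phi>) \<longleftrightarrow> \<not> sat M w \<phi>"
| "sat M w (Conj \<phi> \<psi>) \<longleftrightarrow> sat M w \<phi> \<and> sat M w \<psi>"
| "sat M w (Dia \<phi>) \<longleftrightarrow> (\<exists>v. (w, v) \<in> acc M \<and> sat M v \<phi>)"
| "sat M w (Asg p \<psi> \<phi>) \<longleftrightarrow>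
     sat (M\<lparr>val := (val M)(p := {v \<in> worlds M. sat M v \<psi>})\<rparr>) w \<phi>"
| "sat M w (AsgStar p \<psi> \<phi>) \<longleftrightarrow>
     (\<exists>n. sat (((\<lambda>N. N\<lparr>val := (val N)(p := {v \<in> worlds N. sat N v \<psi>})\<rparr>) ^^ n) M) w \<phi>)"

section \<open>The game\<close>

definition finite_board :: "'w set \<Rightarrow> ('w \<times> 'w) set \<Rightarrow> bool" where
  "finite_board W R \<longleftrightarrow> finite W \<and> W \<noteq> {} \<and> R \<subseteq> W \<times> W"

datatype player = Player0 | Player1

fun opponent :: "player \<Rightarrow> player" where
  "opponent Player0 = Player1"
| "opponent Player1 = Player0"

definition mover :: "nat \<Rightarrow> player" \<comment> \<open>the player to move after \<open>n\<close> moves\<close>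
  where "mover n = (if even n then Player0 else Player1)"

text \<open>
  A play is a pair of its number of moves \<open>N\<close> (possibly \<open>\<infinity>\<close>) and the sequence \<open>x\<close> of
  token positions; only the values of \<open>x\<close> at indices \<open>n \<le> N\<close> are meaningful. A finite play
  ends exactly when the player to move is stuck.
\<close>

definition is_play :: "('w \<times> 'w) set \<Rightarrow> 'w \<Rightarrow> enat \<Rightarrow> (nat \<Rightarrow> 'w) \<Rightarrow> bool" where
  "is_play R s N x \<longleftrightarrow>
     x 0 = s \<and> (\<forall>n. enat n < N \<longrightarrow> (x n, x (Suc n)) \<in> R) \<and>
     (\<forall>n. N = enat n \<longrightarrow> (\<nexists>v. (x n, v) \<in> R))"

definition winner :: "enat \<Rightarrow> player" where
  "winner N = (case N of enat n \<Rightarrow> opponent (mover n) | \<infinity> \<Rightarrow> Player0)"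

text \<open>
  A history is the nonempty list of positions visited so far. A strategy of player \<open>i\<close> must
  prescribe a legal move after every history at which \<open>i\<close> is to move and can move; without
  this requirement an illegal strategy would have no conforming plays and win vacuously.
\<close>

definition is_history :: "('w \<times> 'w) set \<Rightarrow> 'w \<Rightarrow> 'w list \<Rightarrow> bool" where
  "is_history R s h \<longleftrightarrow>
     h \<noteq> [] \<and> hd h = s \<and> (\<forall>n. Suc n < length h \<longrightarrow> (h ! n, h ! Suc n) \<in> R)"

definition is_strategy :: "('w \<times> 'w) set \<Rightarrow> 'w \<Rightarrow> player \<Rightarrow> ('w list \<Rightarrow> 'w) \<Rightarrow> bool" where
  "is_strategy R s i \<sigma> \<longleftrightarrow>
     (\<forall>h. is_history R s h \<and> mover (length h - 1) = i \<and> (\<exists>v. (last h, v) \<in> R)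
        \<longrightarrow> (last h, \<sigma> h) \<in> R)"

definition conforms :: "player \<Rightarrow> ('w list \<Rightarrow> 'w) \<Rightarrow> enat \<Rightarrow> (nat \<Rightarrow> 'w) \<Rightarrow> bool" where
  "conforms i \<sigma> N x \<longleftrightarrow>
     (\<forall>n. enat n < N \<and> mover n = i \<longrightarrow> x (Suc n) = \<sigma> (map x [0..<Suc n]))"

text \<open>A round is two moves, so a play lasts at most \<open>k\<close> rounds iff it has at most \<open>2 * k\<close> moves.\<close>

definition Win_within :: "'w set \<Rightarrow> ('w \<times> 'w) set \<Rightarrow> player \<Rightarrow> nat \<Rightarrow> 'w set" where
  "Win_within W R i k =
     {s \<in> W. \<exists>\<sigma>. is_strategy R s i \<sigma> \<and>
        (\<forall>N x. is_play R s N x \<and> conforms i \<sigma> N x \<longrightarrow>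
           winner N = i \<and> N \<le> enat (2 * k))}"

definition Win1 :: "'w set \<Rightarrow> ('w \<times> 'w) set \<Rightarrow> 'w set" where
  "Win1 W R = (\<Union>k. Win_within W R Player1 k)"

end

theory Submission
  imports Defs
begin

text \<open>
  Both sides of the theorem are stages of one backward induction, made explicit below as
  \<open>attractor W R k\<close>: stage 0 consists of the dead ends, and stage \<open>k + 1\<close> adds the positions at
  which every move of player 0 has an answer leading into stage \<open>k\<close>.

  On the logical side, \<open>p := \<box>\<bottom>\<close> makes \<open>p\<close> denote stage 0, and each execution of
  \<open>p := p \<or> \<box>\<diamond>p\<close> turns the denotation from stage \<open>k\<close> into stage \<open>k + 1\<close>. Only the
  valuation of \<open>p\<close> ever changes, so the formulas read off the stages
  (\<open>iterate_update_eq_attractor\<close>).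

  On the game side, from a position of stage \<open>k\<close> player 1 can lower the stage by one in every round,
  so player 0 gets stuck after at most \<open>k\<close> rounds (\<open>attractor_subset_Win_within\<close>). Conversely,
  from a position outside stage \<open>k\<close> player 0 can stay outside stage \<open>k - n\<close> after \<open>n\<close> rounds, for
  all \<open>n \<le> k\<close>; as stage 0 lies inside every stage, player 0 is never stuck during the first
  \<open>k\<close> rounds nor right after them. Playing this against a supposed winning strategy of player 1
  refutes it (\<open>Win_within_subset_attractor\<close>). The claim about the iteration is the union of the
  claims about the stages.
\<close>

section \<open>The stages of the backward induction\<close>

primrec attractor :: "'w set \<Rightarrow> ('w \<times> 'w) set \<Rightarrow> nat \<Rightarrow> 'w set" where
  "attractor W R 0 = {s \<in> W. \<nexists>v. (s, v) \<in> R}"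
| "attractor W R (Suc k) =
     attractor W R k \<union>
     {s \<in> W. \<forall>v. (s, v) \<in> R \<longrightarrow> (\<exists>u. (v, u) \<in> R \<and> u \<in> attractor W R k)}"

lemma attractor_mono: "j \<le> k \<Longrightarrow> attractor W R j \<subseteq> attractor W R k"
  by (rule lift_Suc_mono_le) auto

text \<open>
  The stages are cumulative, so a position of stage \<open>k\<close> may have entered at any earlier stage; the
  answer then lies even lower, hence still in stage \<open>k - 1\<close>.
\<close>

lemma attractor_step:
  assumes "s \<in> attractor W R k" and "(s, v) \<in> R"
  shows "0 < k \<and> (\<exists>u. (v, u) \<in> R \<and> u \<in> attractor W R (k - 1))"
  using assms(1)
proof (induction k)
  case 0
  then show ?case using assms(2) by simp
next
  case (Suc k)
  show ?case
  proof (cases "s \<in> attractor W R k")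
    case True
    then show ?thesis
      using Suc.IH attractor_mono[of "k - 1" k W R] by auto
  next
    case False
    then show ?thesis using Suc.prems assms(2) by auto
  qed
qed

lemma not_attractor_has_move:
  assumes "s \<in> W" and "s \<notin> attractor W R k"
  shows "\<exists>v. (s, v) \<in> R"
  using assms attractor_mono[of 0 k W R] by auto

section \<open>Iterated assignment computes the stages\<close>

definition update :: "'p \<Rightarrow> 'p fm \<Rightarrow> ('w, 'p) model \<Rightarrow> ('w, 'p) model" where
  "update p \<psi> M = M\<lparr>val := (val M)(p := {v \<in> worlds M. sat M v \<psi>})\<rparr>"

lemma sat_Asg_funpow:
  "sat M s ((Asg p \<psi> ^^ k) \<phi>) \<longleftrightarrow> sat ((update p \<psi> ^^ k) M) s \<phi>"
proof (induction k arbitrary: M)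
  case (Suc k)
  have "sat M s ((Asg p \<psi> ^^ Suc k) \<phi>) \<longleftrightarrow> sat (update p \<psi> M) s ((Asg p \<psi> ^^ k) \<phi>)"
    by (simp add: update_def)
  then show ?case
    by (simp add: Suc.IH funpow_swap1)
qed simp

lemma sat_AsgStar_iff: "sat M s (AsgStar p \<psi> \<phi>) \<longleftrightarrow> (\<exists>k. sat M s ((Asg p \<psi> ^^ k) \<phi>))"
  by (simp add: sat_Asg_funpow update_def[abs_def])

lemma update_attractor:
  assumes "acc M \<subseteq> worlds M \<times> worlds M"
  shows "update p (Disj (Atom p) (Box (Dia (Atom p))))
           (M\<lparr>val := (val M)(p := attractor (worlds M) (acc M) k)\<rparr>)
         = M\<lparr>val := (val M)(p := attractor (worlds M) (acc M) (Suc k))\<rparr>"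
proof -
  have "attractor (worlds M) (acc M) k \<subseteq> worlds M"
    by (induction k) auto
  then show ?thesis
    by (auto simp: update_def intro!: arg_cong[where f = "\<lambda>S. M\<lparr>val := (val M)(p := S)\<rparr>"])
qed

lemma iterate_update_eq_attractor:
  assumes "acc M \<subseteq> worlds M \<times> worlds M"
  shows "(update p (Disj (Atom p) (Box (Dia (Atom p)))) ^^ k) (update p (Box Bot) M)
         = M\<lparr>val := (val M)(p := attractor (worlds M) (acc M) k)\<rparr>"
proof (induction k)
  case 0
  show ?case by (simp add: update_def fun_upd_def)
next
  case (Suc k)
  then show ?case by (simp only: funpow.simps o_apply update_attractor[OF assms])
qed

lemma sat_iterated_assignment:
  assumes "acc M \<subseteq> worlds M \<times> worlds M"
  shows "sat M s (Asg p (Box Bot) ((Asg p (Disj (Atom p) (Box (Dia (Atom p)))) ^^ k) (Atom p)))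
         \<longleftrightarrow> s \<in> attractor (worlds M) (acc M) k"
proof -
  have "sat M s (Asg p (Box Bot) \<phi>) \<longleftrightarrow> sat (update p (Box Bot) M) s \<phi>" for \<phi>
    by (simp add: update_def)
  then show ?thesis
    by (simp only: sat_Asg_funpow iterate_update_eq_attractor[OF assms]) simp
qed

section \<open>Playing from inside and outside a stage\<close>

lemma play_in_board:
  assumes "R \<subseteq> W \<times> W" and "s \<in> W" and "is_play R s N x" and "enat n \<le> N"
  shows "x n \<in> W"
proof (cases n)
  case 0
  then show ?thesis using assms(2,3) by (simp add: is_play_def)
next
  case (Suc m)
  then have "(x m, x n) \<in> R"
    using assms(3,4) by (simp add: is_play_def Suc_ile_eq)
  then show ?thesis using assms(1) by auto
qed

text \<open>
  Player 1 answers by a move that is best for every stage at once. Such a move exists because the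
  stages form a chain: it suffices to reach the least stage that can be reached.
\<close>

lemma uniformly_best_answer:
  assumes "(v, v') \<in> R"
  shows "\<exists>u. (v, u) \<in> R \<and>
           (\<forall>j. (\<exists>u'. (v, u') \<in> R \<and> u' \<in> attractor W R j) \<longrightarrow> u \<in> attractor W R j)"
proof (cases "\<exists>j u'. (v, u') \<in> R \<and> u' \<in> attractor W R j")
  case True
  define reach where "reach j \<longleftrightarrow> (\<exists>u'. (v, u') \<in> R \<and> u' \<in> attractor W R j)" for j
  have "reach (LEAST j. reach j)"
    by (rule LeastI_ex) (use True in \<open>simp add: reach_def\<close>)
  then obtain u where u: "(v, u) \<in> R" "u \<in> attractor W R (LEAST j. reach j)"
    unfolding reach_def by blast
  have "u \<in> attractor W R j" if "reach j" for j
    using u(2) attractor_mono[OF Least_le[of reach, OF that], of W R] by blast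
  then show ?thesis using u(1) unfolding reach_def by blast
next
  case False
  then show ?thesis using assms by blast
qed

lemma attractor_subset_Win_within:
  assumes "R \<subseteq> W \<times> W"
  shows "attractor W R k \<subseteq> Win_within W R Player1 k"
proof
  fix s
  assume s: "s \<in> attractor W R k"
  have "attractor W R k \<subseteq> W"
    by (induction k) auto
  then have sW: "s \<in> W" using s by blast
  define \<sigma> where "\<sigma> h = (SOME u. (last h, u) \<in> R \<and>
      (\<forall>j. (\<exists>u'. (last h, u') \<in> R \<and> u' \<in> attractor W R j) \<longrightarrow> u \<in> attractor W R j))" for h
  have \<sigma>: "(last h, \<sigma> h) \<in> R \<and>
      (\<forall>j. (\<exists>u'. (last h, u') \<in> R \<and> u' \<in> attractor W R j) \<longrightarrow> \<sigma> h \<in> attractor W R j)"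
    if "(last h, v') \<in> R" for h v'
    unfolding \<sigma>_def by (rule someI_ex) (rule uniformly_best_answer[OF that])
  have "is_strategy R s Player1 \<sigma>"
    using \<sigma> unfolding is_strategy_def by blast
  moreover have "winner N = Player1 \<and> N \<le> enat (2 * k)"
    if play: "is_play R s N x" and conf: "conforms Player1 \<sigma> N x" for N x
  proof -
    have x0: "x 0 = s"
      and move: "\<And>n. enat n < N \<Longrightarrow> (x n, x (Suc n)) \<in> R"
      and stuck: "\<And>n v. N = enat n \<Longrightarrow> (x n, v) \<notin> R"
      using play by (auto simp: is_play_def)
    have stage: "n \<le> k \<and> x (2 * n) \<in> attractor W R (k - n)" if "enat (2 * n) \<le> N" for n
      using that
    proof (induction n)
      case 0
      then show ?case using x0 s by simp
    next
      case (Suc n)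
      then have less: "enat (2 * n) < N" "enat (Suc (2 * n)) < N"
        by (cases N; simp)+
      then have IH: "n \<le> k" "x (2 * n) \<in> attractor W R (k - n)"
        using Suc.IH by auto
      let ?h = "map x [0..<Suc (Suc (2 * n))]"
      have answer: "0 < k - n"
        "\<exists>u. (x (Suc (2 * n)), u) \<in> R \<and> u \<in> attractor W R (k - n - 1)"
        using attractor_step[OF IH(2) move[OF less(1)]] by auto
      have "x (Suc (Suc (2 * n))) = \<sigma> ?h"
        using conf less(2) by (simp add: conforms_def mover_def)
      moreover have "last ?h = x (Suc (2 * n))"
        by simp
      ultimately have "x (Suc (Suc (2 * n))) \<in> attractor W R (k - n - 1)"
        using \<sigma>[of ?h] answer(2) by metis
      then show ?case using answer(1) by simp
    qed
    have "N \<le> enat (2 * k)"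
    proof (rule ccontr)
      assume "\<not> N \<le> enat (2 * k)"
      then have "enat (2 * Suc k) \<le> N \<or> N = enat (Suc (2 * k))" and "enat (2 * k) < N"
        by (cases N; auto)+
      then show False
        using stage[of k] move[of "2 * k"] by auto
    qed
    moreover have "winner N = Player1"
    proof -
      obtain m where m: "N = enat m"
        using \<open>N \<le> enat (2 * k)\<close> by (cases N) auto
      \<comment> \<open>Player 1 is never stuck: after complete rounds the token lies in a stage, and every move
          of player 0 from there has an answer.\<close>
      have "even m"
      proof (rule ccontr)
        assume "odd m"
        then obtain n where n: "m = Suc (2 * n)" by (auto elim: oddE)
        then have "enat (2 * n) < N" using m by simp
        then obtain u where "(x m, u) \<in> R"
          using stage[of n] move[of "2 * n"] attractor_step[of "x (2 * n)" W R "k - n"] n by auto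
        then show False using stuck m by blast
      qed
      then show ?thesis using m by (simp add: winner_def mover_def)
    qed
    ultimately show ?thesis by blast
  qed
  ultimately show "s \<in> Win_within W R Player1 k"
    using sW unfolding Win_within_def by blast
qed

text \<open>
  A rule \<open>f\<close> that continues every unfinished history legally, for both players at once, is followed
  by some complete play: extend the history until the player to move is stuck, or for ever.
\<close>

lemma play_following_rule_exists:
  assumes legal: "\<And>h v. is_history R s h \<Longrightarrow> (last h, v) \<in> R \<Longrightarrow> (last h, f h) \<in> R"
  obtains N x where "is_play R s N x"
    and "\<And>n. enat n < N \<Longrightarrow> x (Suc n) = f (map x [0..<Suc n])"
proof -
  define H where "H = rec_nat [s] (\<lambda>n h. h @ [f h])"
  have H_simps: "H 0 = [s]" "H (Suc n) = H n @ [f (H n)]" for n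
    by (simp_all add: H_def)
  define x where "x n = last (H n)" for n
  have map_x: "map x [0..<Suc n] = H n" for n
    by (induction n) (simp_all add: x_def H_simps)
  have x_Suc: "x (Suc n) = f (map x [0..<Suc n])" for n
    unfolding map_x by (simp add: x_def H_simps)
  define stuck where "stuck n \<longleftrightarrow> (\<nexists>v. (x n, v) \<in> R)" for n
  define N where "N = (if \<exists>n. stuck n then enat (LEAST n. stuck n) else \<infinity>)"
  have not_stuck: "\<not> stuck n" if "enat n < N" for n
    using that by (auto simp: N_def split: if_splits dest: not_less_Least)
  have stuck_N: "stuck n" if "N = enat n" for n
  proof -
    have "\<exists>n. stuck n" and "n = (LEAST n. stuck n)"
      using that unfolding N_def by (metis enat.distinct(1) enat.inject)+
    then show ?thesis using LeastI_ex[of stuck] by blast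
  qed
  have move: "(x n, x (Suc n)) \<in> R" if "enat n < N" for n
    using that
  proof (induction n rule: less_induct)
    case (less n)
    have steps: "(x m, x (Suc m)) \<in> R" if "m < n" for m
      using less.IH[OF that] that less.prems by (meson enat_ord_simps(2) order.strict_trans)
    have "x 0 = s" by (simp add: x_def H_simps)
    then have "is_history R s (map x [0..<Suc n])"
      using steps by (auto simp: is_history_def hd_map nth_append simp del: upt_Suc)
    moreover have "last (map x [0..<Suc n]) = x n" by simp
    moreover obtain v where "(x n, v) \<in> R"
      using not_stuck[OF less.prems] by (auto simp: stuck_def)
    ultimately show ?case using legal x_Suc by metis
  qed
  have "is_play R s N x"
    using move stuck_N by (auto simp: is_play_def stuck_def x_def H_simps)
  then show ?thesis using x_Suc that by blast
qed

lemma Win_within_subset_attractor: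
  assumes "R \<subseteq> W \<times> W"
  shows "Win_within W R Player1 k \<subseteq> attractor W R k"
proof
  fix s
  assume "s \<in> Win_within W R Player1 k"
  then obtain \<sigma> where sW: "s \<in> W" and strat: "is_strategy R s Player1 \<sigma>"
    and wins: "\<And>N x. is_play R s N x \<Longrightarrow> conforms Player1 \<sigma> N x \<Longrightarrow>
                 winner N = Player1 \<and> N \<le> enat (2 * k)"
    unfolding Win_within_def by blast
  show "s \<in> attractor W R k"
  proof (rule ccontr)
    assume s: "s \<notin> attractor W R k"
    \<comment> \<open>The implication keeps \<open>evades\<close> satisfiable at positions that already lie in the stage, where
        the rule below must still give a legal move.\<close>
    define evades where "evades w j v \<longleftrightarrow> (w, v) \<in> R \<and>
      (w \<notin> attractor W R (Suc j) \<longrightarrow> (\<forall>u. (v, u) \<in> R \<longrightarrow> u \<notin> attractor W R j))" for w v j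
    have evades_ex: "\<exists>v. evades w j v" if "(w, v') \<in> R" for w j v'
    proof (cases "w \<in> attractor W R (Suc j)")
      case True
      then show ?thesis using that by (auto simp: evades_def)
    next
      case False
      moreover have "w \<in> W" using that assms by auto
      ultimately show ?thesis by (auto simp: evades_def)
    qed
    \<comment> \<open>A history of \<open>n\<close> complete rounds has length \<open>2 * n + 1\<close>, and player 0 must then keep the next
        round outside stage \<open>k - n - 1\<close>.\<close>
    define f where "f h =
      (if mover (length h - 1) = Player1 then \<sigma> h
       else SOME v. evades (last h) (k - length h div 2 - 1) v)" for h
    have f_evades: "evades (last h) (k - length h div 2 - 1) (f h)"
      if "mover (length h - 1) \<noteq> Player1" and "(last h, v') \<in> R" for h v'
      using that(1) someI_ex[OF evades_ex[OF that(2)]] by (simp add: f_def)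
    have "(last h, f h) \<in> R" if "is_history R s h" and "(last h, v) \<in> R" for h v
    proof (cases "mover (length h - 1) = Player1")
      case True
      then show ?thesis using that strat by (auto simp: is_strategy_def f_def)
    next
      case False
      then show ?thesis using f_evades[OF False that(2)] by (simp add: evades_def)
    qed
    then obtain N x where play: "is_play R s N x"
      and follows: "\<And>n. enat n < N \<Longrightarrow> x (Suc n) = f (map x [0..<Suc n])"
      using play_following_rule_exists[of R s f] by blast
    have conf: "conforms Player1 \<sigma> N x"
      using follows by (auto simp: conforms_def f_def simp del: upt_Suc)
    then have N: "winner N = Player1" "N \<le> enat (2 * k)"
      using wins[OF play] by auto
    have x0: "x 0 = s"
      and move: "\<And>n. enat n < N \<Longrightarrow> (x n, x (Suc n)) \<in> R"
      and stuck: "\<And>n v. N = enat n \<Longrightarrow> (x n, v) \<notin> R"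
      using play by (auto simp: is_play_def)
    have outside: "x (2 * n) \<notin> attractor W R (k - n)" if "enat (2 * n) \<le> N" and "n \<le> k" for n
      using that
    proof (induction n)
      case 0
      then show ?case using x0 s by simp
    next
      case (Suc n)
      then have less: "enat (2 * n) < N" "enat (Suc (2 * n)) < N"
        by (cases N; simp)+
      then have IH: "x (2 * n) \<notin> attractor W R (Suc (k - n - 1))"
        using Suc by (simp add: Suc_diff_Suc)
      let ?h = "map x [0..<Suc (2 * n)]"
      have h: "last ?h = x (2 * n)" "length ?h div 2 = n" "mover (length ?h - 1) \<noteq> Player1"
        by (simp_all add: mover_def)
      have "evades (x (2 * n)) (k - n - 1) (f ?h)"
        using f_evades[OF h(3)] move[OF less(1)] unfolding h(1,2) by blast
      then have "evades (x (2 * n)) (k - n - 1) (x (Suc (2 * n)))"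
        using follows[OF less(1)] by simp
      then have "x (Suc (Suc (2 * n))) \<notin> attractor W R (k - n - 1)"
        using IH move[OF less(2)] unfolding evades_def by blast
      then show ?case by simp
    qed
    obtain m where m: "N = enat m" using N(2) by (cases N) auto
    have "even m"
      using N(1) m by (auto simp: winner_def mover_def split: if_splits)
    then obtain n where n: "m = 2 * n" by (auto elim: evenE)
    have "x m \<notin> attractor W R (k - n)"
      using outside[of n] N(2) m n by simp
    moreover have "x m \<in> W"
      using play_in_board[OF assms sW play, of m] m by simp
    ultimately show False
      using not_attractor_has_move stuck[OF m] by metis
  qed
qed

lemma Win_within_eq_attractor:
  assumes "R \<subseteq> W \<times> W"
  shows "Win_within W R Player1 k = attractor W R k"
  using attractor_subset_Win_within[OF assms] Win_within_subset_attractor[OF assms] by blast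

section \<open>Defining the winning region\<close>

theorem proposition4p12:
  fixes W :: "'w set" and R :: "('w \<times> 'w) set"
    and V :: "'p::countable \<Rightarrow> 'w set" and M :: "('w, 'p) model" and p :: 'p
  assumes "finite_board W R"
    and "M = \<lparr>worlds = W, acc = R, val = V\<rparr>" and "is_model M"
  shows "(\<forall>k. {s \<in> W. sat M s
                 ((Asg p (Box Bot) \<circ> (Asg p (Disj (Atom p) (Box (Dia (Atom p)))) ^^ k)) (Atom p))}
               = Win_within W R Player1 k) \<and>
         {s \<in> W. sat M s
                 ((Asg p (Box Bot) \<circ> AsgStar p (Disj (Atom p) (Box (Dia (Atom p))))) (Atom p))}
               = Win1 W R"
proof -
  let ?\<psi> = "Disj (Atom p) (Box (Dia (Atom p)))"
  have R: "R \<subseteq> W \<times> W" using assms(1) by (simp add: finite_board_def)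
  have "sat M s (Asg p (Box Bot) ((Asg p ?\<psi> ^^ k) (Atom p))) \<longleftrightarrow> s \<in> Win_within W R Player1 k"
    for s k
    using sat_iterated_assignment[of M s p k] R
    unfolding Win_within_eq_attractor[OF R] assms(2) by simp
  moreover have "sat M s (Asg p (Box Bot) (AsgStar p ?\<psi> (Atom p))) \<longleftrightarrow>
      (\<exists>k. sat M s (Asg p (Box Bot) ((Asg p ?\<psi> ^^ k) (Atom p))))" for s
    by (simp only: sat.simps(5) sat_AsgStar_iff)
  moreover have "Win_within W R Player1 k \<subseteq> W" for k
    by (auto simp: Win_within_def)
  ultimately show ?thesis
    unfolding Win1_def o_apply by (simp only: UN_iff set_eq_iff mem_Collect_eq) blast
qed

end
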